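(* Let $f:\mathbb{R}^n\to\mathbb{R}$ be $L$-smooth and $\alpha$-strongly convex ($L,\alpha>0$), let $\Psi:\mathbb{R}^n\to\mathbb{R}\cup\{+\infty\}$ be closed, proper and convex, let $F=f+\Psi$, and let $\mathbf{x}^*$ be the minimizer of $F$. Let the iterates $\mathbf{z}_k,\mathbf{y}_k$ and the numbers $\tilde\xi_k^2,\tilde\sigma_k^2$ be generated by the geometric descent algorithm described in the context. Then for $k=1,2,\ldots$, $$\tilde\xi_k^2\ge\|\mathbf{y}_k-\mathbf{x}^*\|^2+\frac{2(F(\bar{\mathbf{z}}_{k-1})-F(\mathbf{x}^* ))}{\alpha}\quad\text{and}\quad \tilde\sigma_k^2\ge\|\mathbf{y}_k-\mathbf{x}^*\|^2+\frac{2(F(\bar{\mathbf{z}}_{k})-F(\mathbf{x}^* ))}{\alpha}.$$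
   Context: $f$ is $L$-smooth if it is differentiable and $|f(\mathbf{x})-f(\mathbf{y})-\nabla f(\mathbf{y})^T(\mathbf{x}-\mathbf{y})|\le (L/2)\|\mathbf{x}-\mathbf{y}\|^2$ for all $\mathbf{x},\mathbf{y}$; $f$ is $\alpha$-strongly convex if $f(\mathbf{y})\ge f(\mathbf{x})+\nabla f(\mathbf{x})^T(\mathbf{y}-\mathbf{x})+(\alpha/2)\|\mathbf{x}-\mathbf{y}\|^2$ for all $\mathbf{x},\mathbf{y}$. For $t>0$, $\mathrm{prox}_{t\Psi}(\mathbf{x})=\operatorname{argmin}_{\mathbf{z}}\{\Psi(\mathbf{z})+\|\mathbf{x}-\mathbf{z}\|^2/(2t)\}$, and $G_t(\mathbf{x})=t^{-1}(\mathbf{x}-\mathrm{prox}_{t\Psi}(\mathbf{x}-t\nabla f(\mathbf{x})))$. For every $k$ write $\bar{\mathbf{z}}_k=\mathbf{z}_k-\frac{1}{L}G_{1/L}(\mathbf{z}_k)$ and $\bar{\bar{\mathbf{z}}}_k=\mathbf{z}_k-\frac1\alpha G_{1/L}(\mathbf{z}_k)$. Geometric descent (strongly convex composite case). Fix $\mathbf{x}_0\in\mathbb{R}^n$; set $\mathbf{z}_0=\mathbf{x}_0$, $\mathbf{y}_1=\mathbf{x}_0-\frac1\alpha G_{1/L}(\mathbf{x}_0)$, and $\tilde\xi_1^2=\left(\frac1{\alpha^2}-\frac1{L\alpha}\right)\|G_{1/L}(\mathbf{x}_0)\|^2$. For $k=1,2,\ldots$: (a) let $\mathbf{z}_k\in\mathrm{aff}\{\bar{\mathbf{z}}_{k-1},\mathbf{y}_k\}$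 be any point with $F(\bar{\mathbf{z}}_k)\le F(\bar{\mathbf{z}}_{k-1})-\frac1{2L}\|G_{1/L}(\mathbf{z}_k)\|^2$ and $G_{1/L}(\mathbf{z}_k)^T(\mathbf{y}_k-\mathbf{z}_k)\ge0$; (b) set $\tilde\rho_k^2=\left(1-\frac{\alpha}{L}\right)\frac{\|G_{1/L}(\mathbf{z}_k)\|^2}{\alpha^2}$, $\tilde\sigma_k^2=\tilde\xi_k^2-\frac{\alpha}{L}\frac{\|G_{1/L}(\mathbf{z}_k)\|^2}{\alpha^2}$, $\delta_k^2=\frac{\|G_{1/L}(\mathbf{z}_k)\|^2}{\alpha^2}$; (c) if $\tilde\sigma_k^2\le\tilde\rho_k^2+\delta_k^2$, set $\lambda_{k+1}=\frac{\delta_k^2+\tilde\rho_k^2-\tilde\sigma_k^2}{2\delta_k^2}$ and $\tilde\xi_{k+1}^2=\frac{\tilde\rho_k^2}{2}+\frac{\tilde\sigma_k^2}{2}-\frac{\delta_k^2}{4}-\frac{(\tilde\rho_k^2-\tilde\sigma_k^2)^2}{4\delta_k^2}$; otherwise set $\lambda_{k+1}=0$ and $\tilde\xi_{k+1}^2=\tilde\rho_k^2$; (d) set $\mathbf{y}_{k+1}=(1-\lambda_{k+1})\bar{\bar{\mathbf{z}}}_k+\lambda_{k+1}\mathbf{y}_k$. Here $\tilde\xi_k^2,\tilde\rho_k^2,\tilde\sigma_k^2,\delta_k^2$ are simply names of real numbers (nonnegativity of $\tilde\xi_k^2$ and $\tilde\sigma_k^2$ is not presupposed). The iteration is considered as long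 as the formulas are defined, i.e. $\delta_k\neq0$ whenever the first case of (c) is used. *)

theory Defs
  imports "HOL-Analysis.Analysis"
begin

definition grad :: "('a::real_inner \<Rightarrow> real) \<Rightarrow> 'a \<Rightarrow> 'a" where
  "grad f x = (THE D. GDERIV f x :> D)"

definition L_smooth :: "real \<Rightarrow> ('a::real_inner \<Rightarrow> real) \<Rightarrow> bool" where
  "L_smooth L f \<longleftrightarrow> (\<forall>x. f differentiable (at x)) \<and>
     (\<forall>x y. \<bar>f x - f y - grad f y \<bullet> (x - y)\<bar> \<le> (L / 2) * (norm (x - y))\<^sup>2)"

definition strongly_convex :: "real \<Rightarrow> ('a::real_inner \<Rightarrow> real) \<Rightarrow> bool" where
  "strongly_convex \<alpha> f \<longleftrightarrow>
     (\<forall>x y. f y \<ge> f x + grad f x \<bullet> (y - x) + (\<alpha> / 2) * (norm (x - y))\<^sup>2)"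

(* The library's epigraph is only available for real-valued functions. *)
definition ereal_epigraph :: "('a \<Rightarrow> ereal) \<Rightarrow> ('a \<times> real) set" where
  "ereal_epigraph \<Psi> = {(x, r). \<Psi> x \<le> ereal r}"

(* The first conjunct says that \<Psi> takes values in the reals together with +\<infinity>. *)
definition closed_proper_convex :: "('a::real_normed_vector \<Rightarrow> ereal) \<Rightarrow> bool" where
  "closed_proper_convex \<Psi> \<longleftrightarrow>
     (\<forall>x. \<Psi> x \<noteq> -\<infinity>) \<and> (\<exists>x. \<Psi> x \<noteq> \<infinity>) \<and>
     closed (ereal_epigraph \<Psi>) \<and> convex (ereal_epigraph \<Psi>)"

definition prox :: "real \<Rightarrow> ('a::real_normed_vector \<Rightarrow> ereal) \<Rightarrow> 'a \<Rightarrow> 'a" where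
  "prox t \<Psi> x = arg_min (\<lambda>z. \<Psi> z + ereal ((norm (x - z))\<^sup>2 / (2 * t))) (\<lambda>_. True)"

definition grad_map :: "('a::real_inner \<Rightarrow> real) \<Rightarrow> ('a \<Rightarrow> ereal) \<Rightarrow> real \<Rightarrow> 'a \<Rightarrow> 'a" where
  "grad_map f \<Psi> t x = (1 / t) *\<^sub>R (x - prox t \<Psi> (x - t *\<^sub>R grad f x))"

definition objective :: "('a \<Rightarrow> real) \<Rightarrow> ('a \<Rightarrow> ereal) \<Rightarrow> 'a \<Rightarrow> ereal" where
  "objective f \<Psi> x = ereal (f x) + \<Psi> x"

(* short_step and long_step map z to the points written with one bar and with two bars. *)
definition short_step :: "('a::real_inner \<Rightarrow> real) \<Rightarrow> ('a \<Rightarrow> ereal) \<Rightarrow> real \<Rightarrow> 'a \<Rightarrow> 'a" where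
  "short_step f \<Psi> L z = z - (1 / L) *\<^sub>R grad_map f \<Psi> (1 / L) z"

definition long_step :: "('a::real_inner \<Rightarrow> real) \<Rightarrow> ('a \<Rightarrow> ereal) \<Rightarrow> real \<Rightarrow> real \<Rightarrow> 'a \<Rightarrow> 'a" where
  "long_step f \<Psi> L \<alpha> z = z - (1 / \<alpha>) *\<^sub>R grad_map f \<Psi> (1 / L) z"

definition gd_init where
  "gd_init f \<Psi> L \<alpha> (x0 :: 'a::real_inner) z y (\<xi>2 :: nat \<Rightarrow> real) \<longleftrightarrow>
     z (0::nat) = x0 \<and>
     y (1::nat) = x0 - (1 / \<alpha>) *\<^sub>R grad_map f \<Psi> (1 / L) x0 \<and>
     \<xi>2 1 = (1 / \<alpha>\<^sup>2 - 1 / (L * \<alpha>)) * (norm (grad_map f \<Psi> (1 / L) x0))\<^sup>2"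

(* Steps (a) and (b) of iteration k: choice of z k, then \<rho>2 k, \<sigma>2 k, \<delta>2 k.
   The names ending in 2 stand for the squared symbols and are arbitrary reals. *)
definition gd_search where
  "gd_search f \<Psi> L \<alpha> (z :: nat \<Rightarrow> 'a::real_inner) y
      (\<xi>2 :: nat \<Rightarrow> real) \<rho>2 \<sigma>2 \<delta>2 (k::nat) \<longleftrightarrow>
     (let g = grad_map f \<Psi> (1 / L) (z k) in
       z k \<in> affine hull {short_step f \<Psi> L (z (k - 1)), y k} \<and>
       objective f \<Psi> (short_step f \<Psi> L (z k))
         \<le> objective f \<Psi> (short_step f \<Psi> L (z (k - 1))) - ereal (1 / (2 * L) * (norm g)\<^sup>2) \<and>
       g \<bullet> (y k - z k) \<ge> 0 \<and>
       \<rho>2 k = (1 - \<alpha> / L) * ((norm g)\<^sup>2 / \<alpha>\<^sup>2) \<and>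
       \<sigma>2 k = \<xi>2 k - (\<alpha> / L) * ((norm g)\<^sup>2 / \<alpha>\<^sup>2) \<and>
       \<delta>2 k = (norm g)\<^sup>2 / \<alpha>\<^sup>2)"

(* Steps (c) and (d) of iteration k; \<delta>2 k \<noteq> 0 says that the formulas of the first case are defined. *)
definition gd_update where
  "gd_update f \<Psi> L \<alpha> (z :: nat \<Rightarrow> 'a::real_inner) y
      (\<xi>2 :: nat \<Rightarrow> real) \<rho>2 \<sigma>2 \<delta>2 lam (k::nat) \<longleftrightarrow>
     (if \<sigma>2 k \<le> \<rho>2 k + \<delta>2 k
      then \<delta>2 k \<noteq> 0 \<and>
           lam (k + 1) = (\<delta>2 k + \<rho>2 k - \<sigma>2 k) / (2 * \<delta>2 k) \<and>
           \<xi>2 (k + 1) = \<rho>2 k / 2 + \<sigma>2 k / 2 - \<delta>2 k / 4 - (\<rho>2 k - \<sigma>2 k)\<^sup>2 / (4 * \<delta>2 k)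
      else lam (k + 1) = 0 \<and> \<xi>2 (k + 1) = \<rho>2 k) \<and>
     y (k + 1) = (1 - lam (k + 1)) *\<^sub>R long_step f \<Psi> L \<alpha> (z k) + lam (k + 1) *\<^sub>R y k"

(* A possibly terminating run: (a), (b) are executed in iterations 1..N and (c), (d) in
   iterations 1..M, where the run may stop between (b) and (c), i.e. N = M or N = M + 1.
   For M = N = \<infinity> the run never stops. Exactly z 0..z N, \<sigma>2 1..\<sigma>2 N, y 1..y (M + 1) and
   \<xi>2 1..\<xi>2 (M + 1) are generated; the remaining values of the sequences are irrelevant. *)
definition geometric_descent where
  "geometric_descent f \<Psi> L \<alpha> x0 z y \<xi>2 \<rho>2 \<sigma>2 \<delta>2 lam (M::enat) (N::enat) \<longleftrightarrow>
     M \<le> N \<and> N \<le> eSuc M \<and>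
     gd_init f \<Psi> L \<alpha> x0 z y \<xi>2 \<and>
     (\<forall>k\<ge>1. enat k \<le> N \<longrightarrow> gd_search f \<Psi> L \<alpha> z y \<xi>2 \<rho>2 \<sigma>2 \<delta>2 k) \<and>
     (\<forall>k\<ge>1. enat k \<le> M \<longrightarrow> gd_update f \<Psi> L \<alpha> z y \<xi>2 \<rho>2 \<sigma>2 \<delta>2 lam k)"

end

theory Submission
  imports Defs
begin

text \<open>
  First-order optimality of the proximal step, combined with the two quadratic bounds on \<open>f\<close>,
  gives \<open>F x \<ge> F p + g \<bullet> (x - z) + \<parallel>g\<parallel>\<^sup>2 / (2 L) + (\<alpha> / 2) \<parallel>x - z\<parallel>\<^sup>2\<close> with \<open>p\<close> the short step and
  \<open>g\<close> the gradient mapping at \<open>z\<close>. At the minimizer this says that the ball around the long step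
  with squared radius \<open>\<rho>\<^sup>2 - s\<close>, where \<open>s = 2 (F p - F x*) / \<alpha>\<close>, contains the minimizer. The descent
  condition puts it also into the ball around \<open>y\<close> with squared radius \<open>\<sigma>\<^sup>2 - s\<close>. The two centers are at
  squared distance at least \<open>\<delta>\<^sup>2\<close>, and the update encloses the intersection of the two balls in a
  smaller one.
\<close>

section \<open>First-order optimality and existence of proximal points\<close>

lemma ereal_epigraph_convexD:
  fixes \<Psi> :: "'a::real_vector \<Rightarrow> ereal"
  assumes "convex (ereal_epigraph \<Psi>)" "\<Psi> x \<le> ereal a" "\<Psi> y \<le> ereal b" "0 \<le> t" "t \<le> 1"
  shows "\<Psi> ((1 - t) *\<^sub>R x + t *\<^sub>R y) \<le> ereal ((1 - t) * a + t * b)"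
  using convexD_alt[OF assms(1), of "(x, a)" "(y, b)" t] assms(2-5)
  by (auto simp: ereal_epigraph_def)

text \<open>On moving from \<open>p\<close> a fraction \<open>t\<close> towards \<open>x\<close>,
  convexity bounds \<Psi> by its chord and \<open>upper\<close> bounds \<phi>; dividing by
  \<open>t\<close> and letting \<open>t\<close> tend to 0 removes the quadratic term. The conclusion
  makes \<open>- d\<close> a subgradient of \<Psi> at \<open>p\<close>.\<close>

lemma first_order_optimality:
  fixes \<Psi> :: "'a::real_inner \<Rightarrow> ereal" and \<phi> :: "'a \<Rightarrow> real"
  assumes conv: "convex (ereal_epigraph \<Psi>)"
    and min: "\<And>x. ereal (\<phi> p) + \<Psi> p \<le> ereal (\<phi> x) + \<Psi> x"
    and upper: "\<And>x. \<phi> x \<le> \<phi> p + d \<bullet> (x - p) + C * (norm (x - p))\<^sup>2"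
    and a: "\<Psi> p = ereal a" and b: "\<Psi> x \<le> ereal b"
  shows "a - d \<bullet> (x - p) \<le> b"
proof -
  have ineq: "0 \<le> (b - a + d \<bullet> (x - p)) + C * t * (norm (x - p))\<^sup>2" if t: "0 < t" "t \<le> 1" for t
  proof -
    define w where "w = (1 - t) *\<^sub>R p + t *\<^sub>R x"
    have wp: "w - p = t *\<^sub>R (x - p)"
      by (simp add: w_def algebra_simps)
    have "\<Psi> w \<le> ereal ((1 - t) * a + t * b)"
      unfolding w_def using t a b by (intro ereal_epigraph_convexD[OF conv]) auto
    then have "ereal (\<phi> w) + \<Psi> w \<le> ereal (\<phi> w + ((1 - t) * a + t * b))"
      by (metis add_left_mono plus_ereal.simps(1))
    with min[of w] have "\<phi> p + a \<le> \<phi> w + ((1 - t) * a + t * b)"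
      using a order_trans by fastforce
    moreover have "\<phi> w \<le> \<phi> p + t * (d \<bullet> (x - p)) + C * (t\<^sup>2 * (norm (x - p))\<^sup>2)"
      using upper[of w] by (simp add: wp power_mult_distrib)
    ultimately have "0 \<le> t * ((b - a + d \<bullet> (x - p)) + C * t * (norm (x - p))\<^sup>2)"
      by (simp add: algebra_simps power2_eq_square)
    then show ?thesis
      using t by (simp add: zero_le_mult_iff)
  qed
  have "((\<lambda>t. (b - a + d \<bullet> (x - p)) + C * t * (norm (x - p))\<^sup>2) \<longlongrightarrow>
      (b - a + d \<bullet> (x - p)) + C * 0 * (norm (x - p))\<^sup>2) (at_right 0)"
    by (intro tendsto_intros)
  moreover have "\<forall>\<^sub>F t in at_right (0::real). 0 \<le> (b - a + d \<bullet> (x - p)) + C * t * (norm (x - p))\<^sup>2"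
    using eventually_at_right_real[of 0 1] by (auto elim!: eventually_mono intro!: ineq)
  ultimately have "0 \<le> (b - a + d \<bullet> (x - p)) + C * 0 * (norm (x - p))\<^sup>2"
    by (rule tendsto_lowerbound) simp
  then show ?thesis by simp
qed

text \<open>As \<Psi> is only lower semicontinuous, Weierstrass is applied on its epigraph, where
  the proximal objective becomes the continuous function \<open>h\<close>. The quadratic term
  dominates the linear decrease allowed by \<open>lower\<close>, so a sublevel set is
  compact.\<close>

lemma prox_objective_attains_min:
  fixes \<Psi> :: "'a::euclidean_space \<Rightarrow> ereal"
  assumes closed: "closed (ereal_epigraph \<Psi>)" and t: "t > 0"
    and w: "\<Psi> w = ereal b"
    and lower: "\<And>z. ereal (c - U * norm (z - x)) \<le> \<Psi> z"
  shows "\<exists>p. is_arg_min (\<lambda>z. \<Psi> z + ereal ((norm (x - z))\<^sup>2 / (2 * t))) (\<lambda>_. True) p"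
proof -
  define q where "q z = (norm (x - z))\<^sup>2 / (2 * t)" for z
  define h where "h = (\<lambda>s::'a \<times> real. snd s + q (fst s))"
  define m where "m = b + q w"
  define S where "S = ereal_epigraph \<Psi> \<inter> {s. h s \<le> m}"
  have cont: "continuous_on A h" for A
    unfolding h_def q_def using t by (intro continuous_intros) auto
  have "closed S"
    unfolding S_def by (intro closed_Int closed closed_Collect_le cont continuous_on_const)
  moreover have "bounded S"
  proof -
    \<comment> \<open>\<open>R\<close> comes from solving the quadratic inequality for the distance
      derived below, \<open>K\<close> from \<open>c - U * n \<le> r\<close> and
      \<open>r \<le> m\<close>.\<close>
    define R where "R = sqrt (4 * t * (m - c + t * U\<^sup>2))"
    define K where "K = \<bar>c\<bar> + \<bar>U\<bar> * R + \<bar>m\<bar>"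
    have "z \<in> cball x R \<and> r \<in> {-K..K}" if "(z, r) \<in> S" for z r
    proof -
      define n where "n = norm (x - z)"
      have r: "c - U * n \<le> r" "r + n\<^sup>2 / (2 * t) \<le> m"
        using that lower[of z]
        by (auto simp: S_def ereal_epigraph_def h_def q_def n_def norm_minus_commute
            dest: order_trans)
      \<comment> \<open>Completing the square: half of the proximal term absorbs
        \<open>U * n\<close>, at the price of \<open>t * U\<^sup>2\<close>.\<close>
      have "0 \<le> (n - 2 * t * U)\<^sup>2 / (4 * t)"
        using t by simp
      also have "\<dots> = n\<^sup>2 / (4 * t) - U * n + t * U\<^sup>2"
        using t by (simp add: field_simps power2_eq_square)
      finally have "n\<^sup>2 / (4 * t) \<le> n\<^sup>2 / (2 * t) - U * n + t * U\<^sup>2"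
        by (simp add: field_simps)
      with r have "n\<^sup>2 / (4 * t) \<le> m - c + t * U\<^sup>2"
        by linarith
      then have "n\<^sup>2 \<le> 4 * t * (m - c + t * U\<^sup>2)"
        using t by (simp add: field_simps)
      then have n: "n \<le> R"
        unfolding R_def by (simp add: real_le_rsqrt)
      have "U * n \<le> \<bar>U\<bar> * R"
        using n by (intro mult_mono) (auto simp: n_def)
      moreover have "0 \<le> n\<^sup>2 / (2 * t)"
        using t by simp
      moreover have "0 \<le> \<bar>U\<bar> * R"
        using n order_trans[of 0 n R] by (auto simp: n_def)
      ultimately have "r \<in> {-K..K}"
        using r by (auto simp: K_def)
      with n show ?thesis
        by (simp add: n_def dist_norm)
    qed
    then have "S \<subseteq> cball x R \<times> {-K..K}"
      by auto
    then show ?thesis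
      using bounded_subset[OF bounded_Times[OF bounded_cball bounded_closed_interval]] by blast
  qed
  ultimately have "compact S"
    by (simp add: compact_eq_bounded_closed)
  moreover have wS: "(w, b) \<in> S"
    by (simp add: S_def ereal_epigraph_def w h_def m_def)
  ultimately obtain s where s: "s \<in> S" and smin: "\<And>s'. s' \<in> S \<Longrightarrow> h s \<le> h s'"
    using continuous_attains_inf[of S h] cont by blast
  \<comment> \<open>Outside \<open>S\<close>, points of the epigraph have \<open>h\<close> above
    \<open>m\<close>, which the value at \<open>s\<close> does not exceed.\<close>
  have epi_min: "h s \<le> h s'" if "s' \<in> ereal_epigraph \<Psi>" for s'
  proof (cases "h s' \<le> m")
    case True
    with that show ?thesis by (auto simp: S_def intro: smin)
  next
    case False
    moreover have "h s \<le> m"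
      using s by (simp add: S_def)
    ultimately show ?thesis by simp
  qed
  have "\<Psi> (fst s) + ereal (q (fst s)) \<le> \<Psi> z + ereal (q z)" for z
  proof -
    have "\<Psi> (fst s) \<le> ereal (snd s)"
      using s by (auto simp: S_def ereal_epigraph_def)
    then have le: "\<Psi> (fst s) + ereal (q (fst s)) \<le> ereal (h s)"
      unfolding h_def by (metis add_right_mono plus_ereal.simps(1))
    show ?thesis
    proof (cases "\<Psi> z")
      case (real r)
      then have "h s \<le> r + q z"
        using epi_min[of "(z, r)"] by (simp add: ereal_epigraph_def h_def)
      with le show ?thesis
        by (simp add: real) (use order_trans in fastforce)
    next
      case MInf
      then show ?thesis using lower[of z] by simp
    qed auto
  qed
  then show ?thesis
    unfolding is_arg_min_linorder q_def by blast
qed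

lemma prox_is_arg_min:
  assumes "\<exists>p. is_arg_min (\<lambda>z. \<Psi> z + ereal ((norm (x - z))\<^sup>2 / (2 * t))) (\<lambda>_. True) p"
  shows "is_arg_min (\<lambda>z. \<Psi> z + ereal ((norm (x - z))\<^sup>2 / (2 * t))) (\<lambda>_. True) (prox t \<Psi> x)"
  unfolding prox_def arg_min_def using assms by (rule someI_ex)

lemma objective_minimizer_finite:
  assumes "closed_proper_convex \<Psi>" and "is_arg_min (objective f \<Psi>) (\<lambda>_. True) x"
  obtains a where "\<Psi> x = ereal a"
proof (cases "\<Psi> x")
  case PInf
  obtain w where w: "\<Psi> w \<noteq> \<infinity>"
    using assms(1) by (auto simp: closed_proper_convex_def)
  have "objective f \<Psi> x \<le> objective f \<Psi> w"
    using assms(2) by (simp add: is_arg_min_linorder)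
  with w show ?thesis
    by (simp add: objective_def PInf)
next
  case MInf
  then show ?thesis using assms(1) by (auto simp: closed_proper_convex_def)
qed (use that in auto)

text \<open>The minimizer of the objective supplies the minorant from which existence follows: by
  optimality, \<open>- grad f xstar\<close> is a subgradient of \<Psi> at \<open>xstar\<close>, so
  \<Psi> lies above an affine function.\<close>

lemma prox_minimizes:
  fixes \<Psi> :: "'a::euclidean_space \<Rightarrow> ereal"
  assumes smooth: "L_smooth L f" and cpc: "closed_proper_convex \<Psi>"
    and xs: "is_arg_min (objective f \<Psi>) (\<lambda>_. True) xstar" and t: "t > 0"
  shows "is_arg_min (\<lambda>z. \<Psi> z + ereal ((norm (x - z))\<^sup>2 / (2 * t))) (\<lambda>_. True) (prox t \<Psi> x)"
proof -
  obtain a where a: "\<Psi> xstar = ereal a"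
    using objective_minimizer_finite[OF cpc xs] .
  define d where "d = grad f xstar"
  \<comment> \<open>Cauchy-Schwarz and the triangle inequality recentre the affine minorant from
    \<open>xstar\<close> to \<open>x\<close>, which costs the constant
    \<open>norm d * norm (x - xstar)\<close>.\<close>
  have lower: "ereal ((a - norm d * norm (x - xstar)) - norm d * norm (z - x)) \<le> \<Psi> z" for z
  proof (cases "\<Psi> z")
    case (real b)
    have upper: "f y \<le> f xstar + d \<bullet> (y - xstar) + (L / 2) * (norm (y - xstar))\<^sup>2" for y
    proof -
      have "\<bar>f y - f xstar - d \<bullet> (y - xstar)\<bar> \<le> (L / 2) * (norm (y - xstar))\<^sup>2"
        using smooth unfolding L_smooth_def d_def by blast
      then show ?thesis by linarith
    qed
    have "a - d \<bullet> (z - xstar) \<le> b"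
    proof (rule first_order_optimality[of \<Psi> f xstar d "L / 2"])
      show "ereal (f xstar) + \<Psi> xstar \<le> ereal (f y) + \<Psi> y" for y
        using xs by (simp add: is_arg_min_linorder objective_def)
    qed (use cpc upper a real in \<open>auto simp: closed_proper_convex_def\<close>)
    moreover have "d \<bullet> (z - xstar) \<le> norm d * norm (z - xstar)"
      by (rule norm_cauchy_schwarz)
    moreover have "norm d * norm (z - xstar) \<le> norm d * (norm (z - x) + norm (x - xstar))"
      using norm_triangle_ineq[of "z - x" "x - xstar"] by (intro mult_left_mono) auto
    ultimately show ?thesis
      by (simp add: real algebra_simps)
  qed (use cpc in \<open>auto simp: closed_proper_convex_def\<close>)
  show ?thesis
    using cpc a t lower
    by (intro prox_is_arg_min prox_objective_attains_min) (auto simp: closed_proper_convex_def)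
qed

section \<open>The gradient mapping inequality\<close>

lemma norm_diff_scaleR_power2:
  fixes g x z :: "'a::real_inner"
  shows "(norm (z - c *\<^sub>R g - x))\<^sup>2 = (norm (x - z))\<^sup>2 + 2 * c * (g \<bullet> (x - z)) + c\<^sup>2 * (norm g)\<^sup>2"
  unfolding power2_norm_eq_inner
  by (simp add: inner_diff inner_commute power2_eq_square algebra_simps)

text \<open>Three estimates are added: optimality of the proximal point, smoothness between
  \<open>z\<close> and \<open>p z\<close>, and strong convexity between \<open>z\<close> and
  \<open>x\<close>. As the objective may be infinite at \<open>x\<close>, the result is stated
  against any real \<open>c\<close> above its value.\<close>

lemma gradient_mapping_bound:
  fixes \<Psi> :: "'a::euclidean_space \<Rightarrow> ereal"
  assumes L: "L > 0" and smooth: "L_smooth L f" and sc: "strongly_convex \<alpha> f"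
    and cpc: "closed_proper_convex \<Psi>" and xs: "is_arg_min (objective f \<Psi>) (\<lambda>_. True) xstar"
  defines "g \<equiv> \<lambda>z. grad_map f \<Psi> (1 / L) z" and "p \<equiv> \<lambda>z. short_step f \<Psi> L z"
  obtains Fp where "objective f \<Psi> (p z) = ereal Fp"
    and "\<And>x c. objective f \<Psi> x \<le> ereal c \<Longrightarrow>
      Fp + g z \<bullet> (x - z) + (norm (g z))\<^sup>2 / (2 * L) + (\<alpha> / 2) * (norm (x - z))\<^sup>2 \<le> c"
proof -
  define d where "d = grad f z"
  define v where "v = z - (1 / L) *\<^sub>R d"
  define q where "q y = (norm (v - y))\<^sup>2 / (2 * (1 / L))" for y
  have p_prox: "p z = prox (1 / L) \<Psi> v"
    using L by (simp add: p_def short_step_def grad_map_def v_def d_def)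
  have zp: "p z = z - (1 / L) *\<^sub>R g z"
    by (simp add: p_def g_def short_step_def)
  have "is_arg_min (\<lambda>y. \<Psi> y + ereal (q y)) (\<lambda>_. True) (p z)"
    unfolding p_prox q_def using L by (intro prox_minimizes[OF smooth cpc xs]) simp
  then have min: "ereal (q (p z)) + \<Psi> (p z) \<le> ereal (q y) + \<Psi> y" for y
    by (simp add: is_arg_min_linorder add.commute)
  \<comment> \<open>Here \<open>q\<close> takes the role of \<open>f\<close>, so that the proximal
    objective is an instance of \<open>objective\<close>.\<close>
  obtain b where b: "\<Psi> (p z) = ereal b"
    using objective_minimizer_finite[OF cpc, of q "p z"] min
    by (auto simp: is_arg_min_linorder objective_def)
  show thesis
  proof
    show Fp: "objective f \<Psi> (p z) = ereal (f (p z) + b)"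
      by (simp add: objective_def b)
    fix x c assume c: "objective f \<Psi> x \<le> ereal c"
    then obtain r where r: "\<Psi> x = ereal r"
      using cpc by (cases "\<Psi> x") (auto simp: objective_def closed_proper_convex_def)
    \<comment> \<open>The expansion of a quadratic is exact, so it serves as the upper bound
      required for first-order optimality.\<close>
    have q_expand: "q y = q (p z) + (L *\<^sub>R (p z - v)) \<bullet> (y - p z) + (L / 2) * (norm (y - p z))\<^sup>2" for y
    proof -
      have eq: "(norm (v - y))\<^sup>2 = (norm (v - p z))\<^sup>2 + 2 * ((p z - v) \<bullet> (y - p z)) + (norm (y - p z))\<^sup>2"
        using norm_diff_scaleR_power2[of v 1 "y - p z" "p z"]
        by (simp add: norm_minus_commute inner_commute)
      have q_eq: "q u = L / 2 * (norm (v - u))\<^sup>2" for u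
        by (simp add: q_def)
      show ?thesis
        unfolding q_eq eq by (simp add: distrib_left)
    qed
    have "b - (L *\<^sub>R (p z - v)) \<bullet> (x - p z) \<le> r"
    proof (rule first_order_optimality)
      show "convex (ereal_epigraph \<Psi>)"
        using cpc by (simp add: closed_proper_convex_def)
      show "q y \<le> q (p z) + (L *\<^sub>R (p z - v)) \<bullet> (y - p z) + (L / 2) * (norm (y - p z))\<^sup>2" for y
        using q_expand[of y] by linarith
    qed (use min b r in auto)
    \<comment> \<open>Thus \<open>g z - d\<close> is a subgradient of \<Psi> at
      \<open>p z\<close>.\<close>
    moreover have "L *\<^sub>R (p z - v) = d - g z"
      using L by (simp add: zp v_def algebra_simps)
    ultimately have psi: "b + (g z - d) \<bullet> (x - p z) \<le> r"
      by (simp add: inner_diff_left)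
    have "\<bar>f (p z) - f z - d \<bullet> (p z - z)\<bar> \<le> (L / 2) * (norm (p z - z))\<^sup>2"
      using smooth unfolding L_smooth_def d_def by blast
    moreover have "(L / 2) * (norm (p z - z))\<^sup>2 = (norm (g z))\<^sup>2 / (2 * L)"
      using L by (simp add: zp field_simps power2_eq_square)
    ultimately have up: "f (p z) \<le> f z + d \<bullet> (p z - z) + (norm (g z))\<^sup>2 / (2 * L)"
      by linarith
    have low: "f z + d \<bullet> (x - z) + (\<alpha> / 2) * (norm (x - z))\<^sup>2 \<le> f x"
      using sc unfolding strongly_convex_def d_def by (metis norm_minus_commute)
    have "f x + r \<le> c"
      using c by (simp add: objective_def r)
    \<comment> \<open>All terms in \<open>d\<close> cancel. Moving the base point from
      \<open>p z\<close> to \<open>z\<close> gains \<open>(norm (g z))\<^sup>2 / L\<close>, half of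
      which pays for the smoothness error in \<open>up\<close>.\<close>
    moreover have "(g z - d) \<bullet> (x - p z) + d \<bullet> (x - z) - d \<bullet> (p z - z) = g z \<bullet> (x - z) + (norm (g z))\<^sup>2 / L"
      by (simp add: zp power2_norm_eq_inner inner_diff inner_add inner_commute diff_divide_distrib)
    moreover have "(norm (g z))\<^sup>2 / L = (norm (g z))\<^sup>2 / (2 * L) + (norm (g z))\<^sup>2 / (2 * L)"
      by simp
    ultimately show "(f (p z) + b) + g z \<bullet> (x - z) + (norm (g z))\<^sup>2 / (2 * L)
        + (\<alpha> / 2) * (norm (x - z))\<^sup>2 \<le> c"
      using psi up low by linarith
  qed
qed

text \<open>After scaling by \<open>2 / \<alpha>\<close>, completing the square in \<open>x\<close>
  puts the center at the step of length \<open>1 / \<alpha>\<close>.\<close>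

lemma long_step_bound:
  fixes z :: "'a::real_inner"
  assumes \<alpha>: "\<alpha> > 0"
    and bound: "Fp + g \<bullet> (x - z) + (norm g)\<^sup>2 / (2 * L) + (\<alpha> / 2) * (norm (x - z))\<^sup>2 \<le> c"
  shows "(norm (z - (1 / \<alpha>) *\<^sub>R g - x))\<^sup>2 + 2 * (Fp - c) / \<alpha> \<le> (1 - \<alpha> / L) * ((norm g)\<^sup>2 / \<alpha>\<^sup>2)"
proof -
  have "(norm (z - (1 / \<alpha>) *\<^sub>R g - x))\<^sup>2
      = (norm (x - z))\<^sup>2 + 2 * (g \<bullet> (x - z)) / \<alpha> + (norm g)\<^sup>2 / \<alpha>\<^sup>2"
    using norm_diff_scaleR_power2[of z "1 / \<alpha>" g x] by (simp add: power_divide)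
  moreover have "(2 / \<alpha>) * (Fp + g \<bullet> (x - z) + (norm g)\<^sup>2 / (2 * L) + (\<alpha> / 2) * (norm (x - z))\<^sup>2) \<le> (2 / \<alpha>) * c"
    using \<alpha> bound by (intro mult_left_mono) auto
  moreover have "(2 / \<alpha>) * (Fp + g \<bullet> (x - z) + (norm g)\<^sup>2 / (2 * L) + (\<alpha> / 2) * (norm (x - z))\<^sup>2)
      = 2 * Fp / \<alpha> + 2 * (g \<bullet> (x - z)) / \<alpha> + (norm g)\<^sup>2 / (L * \<alpha>) + (norm (x - z))\<^sup>2"
    using \<alpha> by (simp add: distrib_left mult.commute)
  moreover have "(1 - \<alpha> / L) * ((norm g)\<^sup>2 / \<alpha>\<^sup>2) = (norm g)\<^sup>2 / \<alpha>\<^sup>2 - (norm g)\<^sup>2 / (L * \<alpha>)"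
  proof -
    have "\<alpha> / L * ((norm g)\<^sup>2 / \<alpha>\<^sup>2) = (norm g)\<^sup>2 / (L * \<alpha>)"
      using \<alpha> by (simp add: power2_eq_square)
    then show ?thesis
      by (simp only: left_diff_distrib mult_1)
  qed
  ultimately show ?thesis
    by (simp add: diff_divide_distrib)
qed

section \<open>Enclosing the intersection of two balls\<close>

text \<open>This is Stewart's theorem, valid for every real \<open>t\<close>.\<close>

lemma norm_convex_combination:
  fixes a b x :: "'a::real_inner"
  shows "(norm ((1 - t) *\<^sub>R a + t *\<^sub>R b - x))\<^sup>2
    = (1 - t) * (norm (a - x))\<^sup>2 + t * (norm (b - x))\<^sup>2 - t * (1 - t) * (norm (a - b))\<^sup>2"
  by (simp add: power2_norm_eq_inner inner_commute algebra_simps)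

text \<open>The weight \<open>t\<close> minimizes the bound that Stewart's theorem gives on the
  squared distance to \<open>x\<close>, and the two conditions in \<open>lam\<close> say that it
  lies in [0, 1]. As the weights sum to 1, the common reduction \<open>s\<close> of both squared
  radii carries over unchanged.\<close>

lemma enclosing_ball:
  fixes a b x :: "'a::real_inner"
  assumes a: "(norm (a - x))\<^sup>2 \<le> \<rho> - s" and b: "(norm (b - x))\<^sup>2 \<le> \<sigma> - s"
    and ab: "\<delta> \<le> (norm (a - b))\<^sup>2" and \<delta>: "\<delta> > 0"
    and lam: "\<sigma> \<le> \<rho> + \<delta>" "\<rho> \<le> \<sigma> + \<delta>"
  defines "t \<equiv> (\<delta> + \<rho> - \<sigma>) / (2 * \<delta>)"
  shows "(norm ((1 - t) *\<^sub>R a + t *\<^sub>R b - x))\<^sup>2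
    \<le> \<rho> / 2 + \<sigma> / 2 - \<delta> / 4 - (\<rho> - \<sigma>)\<^sup>2 / (4 * \<delta>) - s"
proof -
  have t: "0 \<le> t" "t \<le> 1"
    using lam \<delta> by (auto simp: t_def field_simps)
  have "(norm ((1 - t) *\<^sub>R a + t *\<^sub>R b - x))\<^sup>2
      \<le> (1 - t) * (\<rho> - s) + t * (\<sigma> - s) - t * (1 - t) * \<delta>"
    unfolding norm_convex_combination using a b ab t
    by (intro diff_mono add_mono mult_left_mono) auto
  also have "\<dots> = \<rho> / 2 + \<sigma> / 2 - \<delta> / 4 - (\<rho> - \<sigma>)\<^sup>2 / (4 * \<delta>) - s"
    using \<delta> by (simp add: t_def field_simps power2_eq_square)
  finally show ?thesis .
qed

section \<open>Induction along the run\<close>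

theorem theorem5p1:
  fixes f :: "real ^ 'n \<Rightarrow> real" and \<Psi> :: "real ^ 'n \<Rightarrow> ereal"
    and L \<alpha> :: real and x0 xstar :: "real ^ 'n"
    and z y :: "nat \<Rightarrow> real ^ 'n"
    and \<xi>2 \<rho>2 \<sigma>2 \<delta>2 lam :: "nat \<Rightarrow> real"
    and M N :: enat
  assumes "L > 0" and "\<alpha> > 0"
    and "L_smooth L f" and "strongly_convex \<alpha> f"
    and "closed_proper_convex \<Psi>"
    and "is_arg_min (objective f \<Psi>) (\<lambda>_. True) xstar"
    and "geometric_descent f \<Psi> L \<alpha> x0 z y \<xi>2 \<rho>2 \<sigma>2 \<delta>2 lam M N"
  shows "(\<forall>k\<ge>1. enat k \<le> eSuc M \<longrightarrow>
            ereal (\<xi>2 k) \<ge> ereal ((norm (y k - xstar))\<^sup>2)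
              + 2 * (objective f \<Psi> (short_step f \<Psi> L (z (k - 1))) - objective f \<Psi> xstar) / ereal \<alpha>)
       \<and> (\<forall>k\<ge>1. enat k \<le> N \<longrightarrow>
            ereal (\<sigma>2 k) \<ge> ereal ((norm (y k - xstar))\<^sup>2)
              + 2 * (objective f \<Psi> (short_step f \<Psi> L (z k)) - objective f \<Psi> xstar) / ereal \<alpha>)"
proof -
  let ?F = "objective f \<Psi>" and ?p = "\<lambda>z. short_step f \<Psi> L z" and ?g = "\<lambda>z. grad_map f \<Psi> (1 / L) z"
  note L = assms(1) and \<alpha> = assms(2) and cpc = assms(5) and xs = assms(6)
  obtain a where "\<Psi> xstar = ereal a"
    using objective_minimizer_finite[OF cpc xs] .
  then obtain c where c: "?F xstar = ereal c"
    by (simp add: objective_def)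
  \<comment> \<open>The objective is finite at every short step, so the argument can be carried out
    with a real function \<open>Fp\<close>.\<close>
  have "\<exists>Fp. ?F (?p w) = ereal Fp \<and>
      (norm (long_step f \<Psi> L \<alpha> w - xstar))\<^sup>2 + 2 * (Fp - c) / \<alpha>
        \<le> (1 - \<alpha> / L) * ((norm (?g w))\<^sup>2 / \<alpha>\<^sup>2)" for w
    using gradient_mapping_bound[OF L assms(3,4) cpc xs, of w] long_step_bound[OF \<alpha>] c
    unfolding long_step_def by (metis order_refl)
  then obtain Fp where Fp: "\<And>w. ?F (?p w) = ereal (Fp w)"
    and long: "\<And>w. (norm (long_step f \<Psi> L \<alpha> w - xstar))\<^sup>2 + 2 * (Fp w - c) / \<alpha>
        \<le> (1 - \<alpha> / L) * ((norm (?g w))\<^sup>2 / \<alpha>\<^sup>2)"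
    by metis
  have Fp_ge: "c \<le> Fp w" for w
    using xs c Fp[of w] by (metis ereal_less_eq(3) is_arg_min_linorder)
  have MN: "M \<le> N" "N \<le> eSuc M" and init: "gd_init f \<Psi> L \<alpha> x0 z y \<xi>2"
    and search: "\<And>k. k \<ge> 1 \<Longrightarrow> enat k \<le> N \<Longrightarrow> gd_search f \<Psi> L \<alpha> z y \<xi>2 \<rho>2 \<sigma>2 \<delta>2 k"
    and update: "\<And>k. k \<ge> 1 \<Longrightarrow> enat k \<le> M \<Longrightarrow> gd_update f \<Psi> L \<alpha> z y \<xi>2 \<rho>2 \<sigma>2 \<delta>2 lam k"
    using assms(7) by (auto simp: geometric_descent_def)
  \<comment> \<open>Scaled by \<open>2 / \<alpha>\<close>, the guaranteed descent is exactly what is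
    subtracted from \<open>\<xi>2 k\<close> to form \<open>\<sigma>2 k\<close>. The bound on
    \<open>\<xi>2 k\<close> stays a premise, to be met by the induction hypothesis below.\<close>
  have \<sigma>: "(norm (y k - xstar))\<^sup>2 + 2 * (Fp (z k) - c) / \<alpha> \<le> \<sigma>2 k"
    if k: "k \<ge> 1" "enat k \<le> N"
      and \<xi>: "(norm (y k - xstar))\<^sup>2 + 2 * (Fp (z (k - 1)) - c) / \<alpha> \<le> \<xi>2 k" for k
  proof -
    have "Fp (z k) \<le> Fp (z (k - 1)) - 1 / (2 * L) * (norm (?g (z k)))\<^sup>2"
      and \<sigma>2: "\<sigma>2 k = \<xi>2 k - (\<alpha> / L) * ((norm (?g (z k)))\<^sup>2 / \<alpha>\<^sup>2)"
      using search[OF k] by (auto simp: gd_search_def Let_def Fp)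
    then have "(2 / \<alpha>) * (Fp (z k) - c) \<le> (2 / \<alpha>) * (Fp (z (k - 1)) - 1 / (2 * L) * (norm (?g (z k)))\<^sup>2 - c)"
      using \<alpha> by (intro mult_left_mono) auto
    also have "\<dots> = 2 * (Fp (z (k - 1)) - c) / \<alpha> - (\<alpha> / L) * ((norm (?g (z k)))\<^sup>2 / \<alpha>\<^sup>2)"
      using \<alpha> by (simp add: algebra_simps diff_divide_distrib power2_eq_square)
    finally show ?thesis
      using \<xi> \<sigma>2 by simp
  qed
  have \<xi>: "(norm (y k - xstar))\<^sup>2 + 2 * (Fp (z (k - 1)) - c) / \<alpha> \<le> \<xi>2 k"
    if "k \<ge> 1" "enat k \<le> eSuc M" for k
    using that
  proof (induction k rule: nat_induct_at_least)
    \<comment> \<open>The point \<open>y 1\<close> is the long step from \<open>x0\<close>, and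
      \<open>\<xi>2 1\<close> is its squared radius.\<close>
    case base
    have "(1 - \<alpha> / L) * ((norm (?g x0))\<^sup>2 / \<alpha>\<^sup>2) = (1 / \<alpha>\<^sup>2 - 1 / (L * \<alpha>)) * (norm (?g x0))\<^sup>2"
      using L \<alpha> by (simp add: field_simps power2_eq_square)
    then show ?case
      using init long[of x0] by (simp add: gd_init_def long_step_def)
  next
    case (Suc k)
    \<comment> \<open>Values with index \<open>Suc k\<close> are produced by update
      \<open>k\<close>.\<close>
    then have kM: "enat k \<le> M"
      by (simp flip: eSuc_enat)
    then have kN: "enat k \<le> N" and "enat k \<le> eSuc M"
      using MN ile_eSuc order_trans by blast+
    define g where "g = ?g (z k)"
    define s where "s = 2 * (Fp (z k) - c) / \<alpha>"
    define A where "A = long_step f \<Psi> L \<alpha> (z k)"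
    have srch: "0 \<le> g \<bullet> (y k - z k)" "\<rho>2 k = (1 - \<alpha> / L) * ((norm g)\<^sup>2 / \<alpha>\<^sup>2)"
        "\<delta>2 k = (norm g)\<^sup>2 / \<alpha>\<^sup>2"
      using search[OF Suc.hyps kN] by (auto simp: gd_search_def Let_def g_def)
    have B: "(norm (y k - xstar))\<^sup>2 \<le> \<sigma>2 k - s"
      using \<sigma>[OF Suc.hyps kN] Suc.IH \<open>enat k \<le> eSuc M\<close> by (simp add: s_def)
    have A: "(norm (A - xstar))\<^sup>2 \<le> \<rho>2 k - s"
      using long[of "z k"] srch(2) by (simp add: A_def s_def g_def)
    have "0 \<le> s"
      using Fp_ge[of "z k"] \<alpha> by (simp add: s_def)
    \<comment> \<open>Nonnegativity is not presupposed; it holds because the ball around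
      \<open>y k\<close> contains \<open>xstar\<close>. It yields the condition that keeps the
      weight at most 1.\<close>
    then have "0 \<le> \<sigma>2 k"
      using B zero_le_power2[of "norm (y k - xstar)"] by linarith
    moreover have "\<rho>2 k \<le> \<delta>2 k"
      using mult_right_mono[of "1 - \<alpha> / L" 1 "(norm g)\<^sup>2 / \<alpha>\<^sup>2"] L \<alpha> by (simp add: srch)
    ultimately have \<rho>: "\<rho>2 k \<le> \<sigma>2 k + \<delta>2 k"
      by simp
    \<comment> \<open>The sign condition on \<open>g\<close> in the search makes the cross term
      nonnegative, which separates the centers.\<close>
    have "(norm (A - y k))\<^sup>2 = (norm (z k - y k))\<^sup>2 + 2 * (g \<bullet> (y k - z k)) / \<alpha> + \<delta>2 k"
      using norm_diff_scaleR_power2[of "z k" "1 / \<alpha>" g "y k"]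
      by (simp add: A_def long_step_def g_def[symmetric] srch power_divide norm_minus_commute)
    moreover have "0 \<le> 2 * (g \<bullet> (y k - z k)) / \<alpha>"
      using srch(1) \<alpha> by simp
    ultimately have AB: "\<delta>2 k \<le> (norm (A - y k))\<^sup>2"
      by simp
    have y: "y (Suc k) = (1 - lam (Suc k)) *\<^sub>R A + lam (Suc k) *\<^sub>R y k"
      using update[OF Suc.hyps kM] by (simp add: gd_update_def A_def)
    have "(norm (y (Suc k) - xstar))\<^sup>2 \<le> \<xi>2 (Suc k) - s"
    proof (cases "\<sigma>2 k \<le> \<rho>2 k + \<delta>2 k")
      case True
      with update[OF Suc.hyps kM] have upd: "\<delta>2 k \<noteq> 0"
          "lam (Suc k) = (\<delta>2 k + \<rho>2 k - \<sigma>2 k) / (2 * \<delta>2 k)"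
          "\<xi>2 (Suc k) = \<rho>2 k / 2 + \<sigma>2 k / 2 - \<delta>2 k / 4 - (\<rho>2 k - \<sigma>2 k)\<^sup>2 / (4 * \<delta>2 k)"
        by (auto simp: gd_update_def)
      have "\<delta>2 k > 0"
        using upd(1) by (simp add: srch(3) zero_less_divide_iff)
      from enclosing_ball[OF A B AB this True \<rho>] show ?thesis
        unfolding y upd .
    next
      \<comment> \<open>The ball around the long step is kept as it is, with
        \<open>y (Suc k) = A\<close>.\<close>
      case False
      with update[OF Suc.hyps kM] have "lam (Suc k) = 0" "\<xi>2 (Suc k) = \<rho>2 k"
        by (auto simp: gd_update_def)
      then show ?thesis
        using A by (simp add: y)
    qed
    then show ?case
      by (simp add: s_def)
  qed
  have real_form: "ereal r + 2 * (?F (?p w) - ?F xstar) / ereal \<alpha> = ereal (r + 2 * (Fp w - c) / \<alpha>)" for r w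
    unfolding Fp c numeral_eq_ereal using \<alpha> by simp
  \<comment> \<open>Every \<open>\<sigma>2 k\<close> that is generated has a generated
    \<open>\<xi>2 k\<close> to start from.\<close>
  have "enat k \<le> eSuc M" if "enat k \<le> N" for k
    using that MN(2) by (rule order_trans)
  then show ?thesis
    unfolding real_form using \<xi> \<sigma> by simp
qed

end
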